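(* Let $X_1$ and $X_2$ be two nonnegative absolutely continuous random variables with CDFs $K_1$ and $K_2$ and supports $(0,s_1)$ and $(0,s_2)$ respectively ($0<s_1,s_2\le\infty$), let $\gamma>0$, and let $\psi\ge 0$ be a weight function. If $\psi$ is increasing, then $$X_1\le_{disp}X_2\ \Longrightarrow\ CPE_\gamma^\psi(X_1)\le CPE_\gamma^\psi(X_2).$$
   Context: For a nonnegative absolutely continuous random variable $X$ with support $(0,s)$, $0<s\le\infty$, CDF $K$, and a nonnegative weight function $\psi$, the weighted fractional generalized cumulative past entropy (WFGCPE) of order $\gamma>0$ is $$CPE_\gamma^\psi(X)=\frac{1}{\Gamma(\gamma+1)}\int_0^s\psi(x)K(x)[-\ln K(x)]^\gamma\,dx,$$ provided the integral is finite, where $\Gamma$ is the gamma function and the integrand is taken to be $0$ where $K(x)\in\{0,1\}$ (convention $0\cdot\ln 0=0$). The terms increasing and decreasing are used in the wide (non-strict) sense. Derivatives and integrals are assumed to exist whenever they are used. Dispersive order: $X_1\le_{disp}X_2$ if $K_1^{-1}(u)-K_1^{-1}(v)\ge K_2^{-1}(u)-K_2^{-1}(v)$ for all $0<u<v<1$, where $K_1^{-1},K_2^{-1}$ are the right continuous inverses of $K_1,K_2$. If $k_1,k_2$ denote the PDFs, this is equivalently characterized by $k_1(K_1^{-1}(u))\ge k_2(K_2^{-1}(u))$ for $u\in(0,1)$. *)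

theory Defs
  imports "HOL-Probability.Probability"
begin

definition rv_cdf :: "'a measure \<Rightarrow> ('a \<Rightarrow> real) \<Rightarrow> real \<Rightarrow> real" where
  "rv_cdf M X = cdf (distr M borel X)"

definition abs_continuous_rv :: "'a measure \<Rightarrow> ('a \<Rightarrow> real) \<Rightarrow> bool" where
  "abs_continuous_rv M X \<longleftrightarrow>
     X \<in> borel_measurable M \<and> absolutely_continuous lborel (distr M borel X)"

definition measure_support :: "'a::topological_space measure \<Rightarrow> 'a set" where
  "measure_support N = {x. \<forall>U. open U \<longrightarrow> x \<in> U \<longrightarrow> emeasure N U > 0}"

text \<open>
  The support of a distribution is a closed set, so ``the support is the open interval
  from \<open>0\<close> to \<open>s\<close>'' is read as: the support is the closure of that interval in the reals
  (for \<open>s = \<infinity>\<close>, the closed half-line). In particular this holds if \<open>X\<close> has a density that is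
  positive on the open interval and zero off it.
\<close>
definition has_support_upto :: "'a measure \<Rightarrow> ('a \<Rightarrow> real) \<Rightarrow> ereal \<Rightarrow> bool" where
  "has_support_upto M X s \<longleftrightarrow> measure_support (distr M borel X) = closure (einterval 0 s)"

text \<open>
  The integrand needs no case distinction: it vanishes where \<open>K x = 0\<close> because of the factor
  \<open>K x\<close>, and where \<open>K x = 1\<close> because \<open>0 powr \<gamma> = 0\<close>.
\<close>
definition wfgcpe_integrand ::
    "real \<Rightarrow> (real \<Rightarrow> real) \<Rightarrow> (real \<Rightarrow> real) \<Rightarrow> real \<Rightarrow> real" where
  "wfgcpe_integrand \<gamma> \<psi> K x = \<psi> x * K x * (- ln (K x)) powr \<gamma>"

definition wfgcpe_exists ::
    "real \<Rightarrow> (real \<Rightarrow> real) \<Rightarrow> 'a measure \<Rightarrow> ('a \<Rightarrow> real) \<Rightarrow> ereal \<Rightarrow> bool" where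
  "wfgcpe_exists \<gamma> \<psi> M X s \<longleftrightarrow>
     interval_lebesgue_integrable lborel 0 s (wfgcpe_integrand \<gamma> \<psi> (rv_cdf M X))"

text \<open>Meaningful only under \<^const>\<open>wfgcpe_exists\<close>; \<open>s\<close> is the right end of the support of \<open>X\<close>.\<close>
definition wfgcpe ::
    "real \<Rightarrow> (real \<Rightarrow> real) \<Rightarrow> 'a measure \<Rightarrow> ('a \<Rightarrow> real) \<Rightarrow> ereal \<Rightarrow> real" where
  "wfgcpe \<gamma> \<psi> M X s =
     1 / Gamma (\<gamma> + 1) * (LBINT x=0..s. wfgcpe_integrand \<gamma> \<psi> (rv_cdf M X) x)"

text \<open>Right-continuous inverse of a CDF, used only for \<open>0 < u < 1\<close>,
  where the set is nonempty and bounded below.\<close>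
definition rc_inverse :: "(real \<Rightarrow> real) \<Rightarrow> real \<Rightarrow> real" where
  "rc_inverse K u = Inf {x. u < K x}"

definition disp_le ::
    "'a measure \<Rightarrow> ('a \<Rightarrow> real) \<Rightarrow> 'b measure \<Rightarrow> ('b \<Rightarrow> real) \<Rightarrow> bool" where
  "disp_le M1 X1 M2 X2 \<longleftrightarrow>
     (\<forall>u v. 0 < u \<longrightarrow> u < v \<longrightarrow> v < 1 \<longrightarrow>
        rc_inverse (rv_cdf M1 X1) u - rc_inverse (rv_cdf M1 X1) v
          \<ge> rc_inverse (rv_cdf M2 X2) u - rc_inverse (rv_cdf M2 X2) v)"

end

theory Submission
  imports Defs
begin

text \<open>
  On the interior of its support each distribution function is a strictly increasing continuous
  bijection onto \<open>(0, 1)\<close>, so \<open>g = K1\<inverse> \<circ> K2\<close> maps \<open>(0, s2)\<close> onto \<open>(0, s1)\<close> and carries each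
  quantile of \<open>X2\<close> to the quantile of \<open>X1\<close> at the same level. The dispersive order says exactly
  that \<open>g\<close> does not increase distances. As both supports start at \<open>0\<close>, it also gives \<open>g y \<le> y\<close>
  (\<open>disp_le_transport\<close>).

  Since \<open>K1 (g y) = K2 y\<close> and \<open>\<psi>\<close> is increasing, the integrand of \<open>X1\<close> at \<open>g y\<close> is at most that
  of \<open>X2\<close> at \<open>y\<close>. It remains to change variables along \<open>g\<close>: for every nonnegative Borel \<open>f\<close>, the
  integral of \<open>f\<close> over the image of \<open>g\<close> is at most the integral of \<open>f \<circ> g\<close>
  (\<open>nn_integral_le_nonexpansive\<close>). The usual formula would carry the factor \<open>g' \<le> 1\<close>; the
  inequality avoids derivatives altogether, because it only expresses that a map which does not
  increase distances does not increase Lebesgue measure. On a connected set this is a comparison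
  of lengths, open sets split into countably many components, and outer regularity reaches all
  Borel sets (\<open>emeasure_le_vimage_nonexpansive\<close>).
\<close>

section \<open>Distribution functions with an interval as support\<close>

text \<open>
  Every point outside the support has a null neighbourhood; second countability reduces their
  uncountable union to a union of countably many null basic sets.
\<close>
lemma emeasure_Compl_measure_support:
  fixes N :: "'a::second_countable_topology measure"
  assumes "sets N = sets borel"
  shows "emeasure N (- measure_support N) = 0"
proof -
  obtain B :: "'a set set" where B: "countable B" "topological_basis B"
    using ex_countable_basis by blast
  define Z where "Z = {b \<in> B. emeasure N b = 0}"
  have null: "b \<in> null_sets N" if "b \<in> Z" for b
    using that B(2) assms by (auto simp: Z_def topological_basis_open null_sets_def)
  have "- measure_support N \<subseteq> \<Union>Z"
  proof
    fix x assume "x \<in> - measure_support N"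
    then obtain U where U: "open U" "x \<in> U" "emeasure N U = 0"
      by (auto simp: measure_support_def)
    obtain b where b: "b \<in> B" "x \<in> b" "b \<subseteq> U"
      using topological_basisE[OF B(2) U(1,2)] by blast
    have "emeasure N b \<le> emeasure N U"
      using b U assms by (intro emeasure_mono) auto
    with U b show "x \<in> \<Union>Z" by (auto simp: Z_def)
  qed
  moreover have "(\<Union>b\<in>Z. b) \<in> null_sets N"
    using B(1) null by (intro null_sets_UN') (auto simp: Z_def)
  ultimately have "emeasure N (- measure_support N) \<le> emeasure N (\<Union>b\<in>Z. b)"
    by (intro emeasure_mono) auto
  also have "\<dots> = 0"
    using \<open>(\<Union>b\<in>Z. b) \<in> null_sets N\<close> by (rule null_setsD1)
  finally show ?thesis by simp
qed

lemma real_distribution_rv: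
  assumes "prob_space M" "abs_continuous_rv M X"
  shows "real_distribution (distr M borel X)"
  using assms prob_space.prob_space_distr[of M X borel]
  by (auto simp: abs_continuous_rv_def real_distribution_def real_distribution_axioms_def)

lemma singleton_null_sets_distr:
  assumes "abs_continuous_rv M X"
  shows "{x} \<in> null_sets (distr M borel X)"
proof -
  have "{x} \<in> null_sets lborel" by auto
  then show ?thesis
    using assms unfolding abs_continuous_rv_def absolutely_continuous_def by blast
qed

lemma continuous_rv_cdf:
  assumes "prob_space M" "abs_continuous_rv M X"
  shows "isCont (rv_cdf M X) x"
proof -
  interpret real_distribution "distr M borel X"
    by (rule real_distribution_rv[OF assms])
  show ?thesis
    using singleton_null_sets_distr[OF assms(2), of x]
    unfolding rv_cdf_def isCont_cdf by (auto simp: measure_def)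
qed

lemma mono_rv_cdf:
  assumes "prob_space M" "abs_continuous_rv M X"
  shows "mono (rv_cdf M X)"
proof -
  interpret real_distribution "distr M borel X"
    by (rule real_distribution_rv[OF assms])
  show ?thesis by (simp add: rv_cdf_def mono_def cdf_nondecreasing)
qed

lemma rv_cdf_nonpos:
  assumes "prob_space M" "abs_continuous_rv M X" "AE \<omega> in M. 0 \<le> X \<omega>" "x \<le> 0"
  shows "rv_cdf M X x = 0"
proof -
  interpret real_distribution "distr M borel X"
    by (rule real_distribution_rv[OF assms(1,2)])
  have X[measurable]: "X \<in> borel_measurable M"
    using assms(2) by (simp add: abs_continuous_rv_def)
  have "AE y in distr M borel X. 0 \<le> y"
    using assms(3) by (subst AE_distr_iff) auto
  moreover have "AE y in distr M borel X. y \<notin> {0}"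
    by (rule AE_not_in[OF singleton_null_sets_distr[OF assms(2)]])
  ultimately have "AE y in distr M borel X. y \<notin> {..x}"
    by eventually_elim (use assms(4) in auto)
  then have "{..x} \<in> null_sets (distr M borel X)"
    by (subst AE_iff_null_sets) auto
  then show ?thesis
    unfolding rv_cdf_def cdf_def by (auto simp: measure_def)
qed

text \<open>
  Every interval \<open>(x, y)\<close> starting in \<open>[0, s)\<close> meets the support and thus has positive probability.
  The point \<open>x = 0\<close> is included so that positivity on \<open>(0, s)\<close> follows from the value at \<open>0\<close>;
  \<open>y\<close> may lie beyond \<open>s\<close>, which yields values below \<open>1\<close> on \<open>(0, s)\<close>.
\<close>
lemma rv_cdf_strict_mono:
  assumes "prob_space M" "abs_continuous_rv M X" "has_support_upto M X s"
    and "0 \<le> x" "ereal x < s" "x < y"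
  shows "rv_cdf M X x < rv_cdf M X y"
proof -
  interpret real_distribution "distr M borel X"
    by (rule real_distribution_rv[OF assms(1,2)])
  have "ereal x < min s (ereal y)" using assms by auto
  then obtain z where z: "x < z" "ereal z < s" "z < y"
    using ereal_dense2 by fastforce
  then have "z \<in> einterval 0 s" using assms(4) by (auto simp: einterval_def)
  then have "z \<in> measure_support (distr M borel X)"
    using assms(3) closure_subset by (auto simp: has_support_upto_def)
  then have "emeasure (distr M borel X) {x<..<y} > 0"
    using z by (auto simp: measure_support_def)
  then have "0 < measure (distr M borel X) {x<..<y}"
    by (simp add: emeasure_eq_measure)
  also have "\<dots> \<le> measure (distr M borel X) {x<..y}"
    by (intro finite_measure_mono) auto
  also have "\<dots> = rv_cdf M X y - rv_cdf M X x"
    unfolding rv_cdf_def using cdf_diff_eq[OF assms(6)] by simp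
  finally show ?thesis by simp
qed

lemma rv_cdf_right_end:
  assumes "prob_space M" "abs_continuous_rv M X" "has_support_upto M X s"
    and "0 < s" "s \<le> ereal x"
  shows "rv_cdf M X x = 1"
proof -
  interpret real_distribution "distr M borel X"
    by (rule real_distribution_rv[OF assms(1,2)])
  have "measure_support (distr M borel X) \<subseteq> {..x}"
  proof -
    have "einterval 0 s \<subseteq> {..x}"
      using assms(5) by (auto simp: einterval_def dest: less_le_trans)
    then show ?thesis
      using assms(3) closure_minimal[of "einterval 0 s" "{..x}"]
      by (simp add: has_support_upto_def)
  qed
  then have sub: "UNIV - {..x} \<subseteq> - measure_support (distr M borel X)"
    by auto
  have "open (- measure_support (distr M borel X))"
    using assms(3) by (simp add: has_support_upto_def open_Compl)
  then have "emeasure (distr M borel X) (UNIV - {..x}) \<le>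
      emeasure (distr M borel X) (- measure_support (distr M borel X))"
    using sub by (intro emeasure_mono) auto
  also have "\<dots> = 0"
    by (rule emeasure_Compl_measure_support) simp
  finally have "measure (distr M borel X) (UNIV - {..x}) = 0"
    by (simp add: measure_def)
  then show ?thesis
    using prob_compl[of "{..x}"] by (simp add: rv_cdf_def cdf_def)
qed

lemma rv_cdf_bij_betw:
  assumes "prob_space M" "abs_continuous_rv M X" "AE \<omega> in M. 0 \<le> X \<omega>"
    and "has_support_upto M X s" "0 < s"
  shows "bij_betw (rv_cdf M X) (einterval 0 s) {0<..<1}"
proof -
  interpret real_distribution "distr M borel X"
    by (rule real_distribution_rv[OF assms(1,2)])
  let ?K = "rv_cdf M X"
  have strict: "?K x < ?K y" if "0 \<le> x" "ereal x < s" "x < y" for x y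
    by (rule rv_cdf_strict_mono[OF assms(1,2,4) that])
  have K0: "?K 0 = 0"
    by (rule rv_cdf_nonpos[OF assms(1-3)]) simp
  have le1: "?K x \<le> 1" for x
    using prob_le_1 by (simp add: rv_cdf_def cdf_def)
  have "inj_on ?K (einterval 0 s)"
  proof (rule linorder_inj_onI)
    fix x y assume "x < y" "x \<in> einterval 0 s" "y \<in> einterval 0 s"
    then show "?K x \<noteq> ?K y"
      using strict[of x y] by (auto simp: einterval_def)
  qed linarith
  moreover have "?K x \<in> {0<..<1}" if "x \<in> einterval 0 s" for x
    using strict[of 0 x] strict[of x "x + 1"] le1[of "x + 1"] K0 that assms(5)
    by (auto simp: einterval_def zero_ereal_def)
  moreover have "\<exists>x\<in>einterval 0 s. ?K x = u" if u: "0 < u" "u < 1" for u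
  proof -
    have "\<forall>\<^sub>F x in at_top. u < ?K x"
      using order_tendstoD(1)[OF cdf_lim_at_top_prob] u by (simp add: rv_cdf_def)
    then obtain b where b: "0 \<le> b" "u < ?K b"
      using eventually_conj[OF _ eventually_ge_at_top[of "0::real"]]
      by (metis (mono_tags, lifting) eventually_at_top_linorder linorder_linear)
    obtain x where x: "0 \<le> x" "?K x = u"
      using IVT[of ?K 0 u b] b u K0 continuous_rv_cdf[OF assms(1,2)] by auto
    have "x \<noteq> 0" using x u K0 by auto
    moreover have "ereal x < s"
      using rv_cdf_right_end[OF assms(1,2,4,5), of x] x u by force
    ultimately show ?thesis
      using x by (intro bexI[of _ x]) (auto simp: einterval_def)
  qed
  ultimately show ?thesis
    by (fastforce simp: bij_betw_def)
qed

text \<open>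
  Strict monotonicity turns the set of points with a larger value into a half-line that starts
  at \<open>x\<close>, so the right-continuous inverse is a genuine left inverse.
\<close>
lemma rc_inverse_rv_cdf:
  assumes "prob_space M" "abs_continuous_rv M X" "has_support_upto M X s"
    and "x \<in> einterval 0 s"
  shows "rc_inverse (rv_cdf M X) (rv_cdf M X x) = x"
proof -
  have "{z. rv_cdf M X x < rv_cdf M X z} = {x<..}"
    using rv_cdf_strict_mono[OF assms(1-3), of x] assms(4) monoD[OF mono_rv_cdf[OF assms(1,2)]]
    by (auto simp: einterval_def not_less[symmetric])
  then show ?thesis by (simp add: rc_inverse_def)
qed

section \<open>Nonexpansive maps and Lebesgue measure\<close>

text \<open>
  Countable subadditivity for an index set that is merely countable, as the set of components of
  an open set is: a union indicator is dominated by the sum of the indicators.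
\<close>
lemma emeasure_UN_countable_le:
  assumes [measurable]: "\<And>i. i \<in> I \<Longrightarrow> X i \<in> sets M" and "countable I"
  shows "emeasure M (\<Union>(X ` I)) \<le> (\<integral>\<^sup>+i. emeasure M (X i) \<partial>count_space I)"
proof -
  have "emeasure M (\<Union>(X ` I)) = (\<integral>\<^sup>+x. indicator (\<Union>(X ` I)) x \<partial>M)"
    using assms by (intro nn_integral_indicator[symmetric] sets.countable_UN') auto
  also have "\<dots> \<le> (\<integral>\<^sup>+x. \<integral>\<^sup>+i. indicator (X i) x \<partial>count_space I \<partial>M)"
  proof (rule nn_integral_mono)
    fix x
    show "indicator (\<Union>(X ` I)) x \<le> (\<integral>\<^sup>+i. indicator (X i) x \<partial>count_space I :: ennreal)"
    proof (cases "x \<in> \<Union>(X ` I)")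
      case True
      then obtain i where "i \<in> I" "x \<in> X i" by auto
      then show ?thesis
        using nn_integral_ge_point[of i I "\<lambda>i. indicator (X i) x :: ennreal"] True by simp
    qed simp
  qed
  also have "\<dots> = (\<integral>\<^sup>+i. \<integral>\<^sup>+x. indicator (X i) x \<partial>M \<partial>count_space I)"
    using nn_integral_count_space_nn_integral[OF assms(2), of "\<lambda>i. indicator (X i)" M] by simp
  also have "\<dots> = (\<integral>\<^sup>+i. emeasure M (X i) \<partial>count_space I)"
    by (intro nn_integral_cong) auto
  finally show ?thesis .
qed

text \<open>
  A connected set of reals contains the interval between any two of its points, so its diameter is
  at most its measure. The image has no larger diameter, hence fits in an interval of at most that
  length. Unlike the image, such an interval is evidently a Borel set.
\<close>
lemma nonexpansive_image_subset_interval: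
  fixes g :: "real \<Rightarrow> real"
  assumes "connected C" "C \<in> sets borel" "C \<noteq> {}"
    and nonexp: "\<And>x y. x \<in> C \<Longrightarrow> y \<in> C \<Longrightarrow> \<bar>g x - g y\<bar> \<le> \<bar>x - y\<bar>"
    and fin: "emeasure lborel C \<noteq> \<infinity>"
  shows "\<exists>a b. g ` C \<subseteq> {a..b} \<and> emeasure lborel {a..b} \<le> emeasure lborel C"
proof -
  define L where "L = measure lborel C"
  have L: "emeasure lborel C = ennreal L"
    using fin by (simp add: L_def emeasure_eq_ennreal_measure top.not_eq_extremum)
  have diff: "y - x \<le> L" if "x \<in> C" "y \<in> C" "x \<le> y" for x y
  proof -
    have "{x..y} \<subseteq> C"
      using assms(1) that connected_contains_Icc by blast
    then have "emeasure lborel {x..y} \<le> ennreal L"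
      using assms(2) unfolding L[symmetric] by (intro emeasure_mono) auto
    then show ?thesis
      using that(3) by (simp add: L_def)
  qed
  have gdiff: "g x - g y \<le> L" if "x \<in> C" "y \<in> C" for x y
    using nonexp[OF that] diff[OF that] diff[OF that(2,1)] by linarith
  obtain c where c: "c \<in> C" using assms(3) by blast
  have bdd: "bdd_above (g ` C)" "bdd_below (g ` C)"
    using gdiff[OF _ c] gdiff[OF c]
    by (auto intro!: bdd_aboveI[of _ "g c + L"] bdd_belowI[of _ "g c - L"] simp: algebra_simps)
  have "Sup (g ` C) \<le> Inf (g ` C) + L"
  proof (rule cSUP_least[OF assms(3)])
    fix x assume x: "x \<in> C"
    have "g x - L \<le> Inf (g ` C)"
      by (rule cINF_greatest[OF assms(3)]) (use gdiff[OF x] in \<open>simp add: algebra_simps\<close>)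
    then show "g x \<le> Inf (g ` C) + L" by simp
  qed
  moreover have "Inf (g ` C) \<le> Sup (g ` C)"
    using c bdd by (meson cINF_lower cSUP_upper order_trans)
  ultimately have "emeasure lborel {Inf (g ` C)..Sup (g ` C)} \<le> ennreal L"
    by (simp add: ennreal_leI)
  moreover have "g ` C \<subseteq> {Inf (g ` C)..Sup (g ` C)}"
    using bdd by (auto intro: cINF_lower cSUP_upper)
  ultimately show ?thesis unfolding L by blast
qed

text \<open>
  Cover the image of each component by an interval that is not longer than the component, and add
  up: subadditivity over the intervals, additivity over the disjoint components.
\<close>
lemma emeasure_nonexpansive_image_open:
  fixes g :: "real \<Rightarrow> real"
  assumes "open U" and A: "A \<in> sets borel" "A \<subseteq> g ` U"
    and nonexp: "\<And>x y. x \<in> U \<Longrightarrow> y \<in> U \<Longrightarrow> \<bar>g x - g y\<bar> \<le> \<bar>x - y\<bar>"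
  shows "emeasure lborel A \<le> emeasure lborel U"
proof (cases "emeasure lborel U = \<infinity>")
  case False
  let ?\<C> = "components U"
  have op: "open C" if "C \<in> ?\<C>" for C
    using open_components[OF assms(1) that] .
  have disj: "pairwise disjnt ?\<C>"
    using components_nonoverlap by (auto simp: pairwise_def disjnt_def)
  have cnt: "countable ?\<C>"
    by (rule countable_disjoint_open_subsets[OF op disj])
  have "\<exists>J. J \<in> sets borel \<and> g ` C \<subseteq> J \<and> emeasure lborel J \<le> emeasure lborel C" if "C \<in> ?\<C>" for C
  proof -
    have sub: "C \<subseteq> U" using that by (rule in_components_subset)
    then have "emeasure lborel C \<le> emeasure lborel U"
      using assms(1) by (intro emeasure_mono) auto
    then have "emeasure lborel C \<noteq> \<infinity>" using False by (auto simp: top_unique)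
    then have "\<exists>a b. g ` C \<subseteq> {a..b} \<and> emeasure lborel {a..b} \<le> emeasure lborel C"
      using sub op[OF that] that
      by (intro nonexpansive_image_subset_interval nonexp)
         (auto dest: in_components_connected in_components_nonempty)
    then show ?thesis by (meson atLeastAtMost_borel)
  qed
  then obtain J where J: "\<And>C. C \<in> ?\<C> \<Longrightarrow>
      J C \<in> sets borel \<and> g ` C \<subseteq> J C \<and> emeasure lborel (J C) \<le> emeasure lborel C"
    by metis
  have "A \<subseteq> (\<Union>C\<in>?\<C>. J C)"
  proof
    fix a assume "a \<in> A"
    then obtain x where x: "x \<in> U" "a = g x" using A(2) by auto
    then obtain C where "C \<in> ?\<C>" "x \<in> C" by (metis Union_components UnionE)
    then show "a \<in> (\<Union>C\<in>?\<C>. J C)" using J x by blast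
  qed
  then have "emeasure lborel A \<le> emeasure lborel (\<Union>C\<in>?\<C>. J C)"
    using J by (intro emeasure_mono) (auto intro!: sets.countable_UN'[OF cnt])
  also have "\<dots> \<le> (\<integral>\<^sup>+C. emeasure lborel (J C) \<partial>count_space ?\<C>)"
    using J by (intro emeasure_UN_countable_le cnt) auto
  also have "\<dots> \<le> (\<integral>\<^sup>+C. emeasure lborel C \<partial>count_space ?\<C>)"
    using J by (intro nn_integral_mono) auto
  also have "\<dots> = emeasure lborel (\<Union>C\<in>?\<C>. C)"
    using op disj
    by (intro emeasure_UN_countable[symmetric] cnt)
       (auto simp: disjoint_family_on_def pairwise_def disjnt_def)
  also have "(\<Union>C\<in>?\<C>. C) = U" by simp
  finally show ?thesis .
qed simp

lemma nonexpansive_measurable: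
  fixes g :: "real \<Rightarrow> real"
  assumes "\<And>x y. x \<in> S \<Longrightarrow> y \<in> S \<Longrightarrow> \<bar>g x - g y\<bar> \<le> \<bar>x - y\<bar>"
  shows "g \<in> borel_measurable (restrict_space borel S)"
proof (rule borel_measurable_continuous_on_restrict)
  have "1-lipschitz_on S g"
    using assms by (auto simp: lipschitz_on_def dist_real_def)
  then show "continuous_on S g" by (rule lipschitz_on_continuous_on)
qed

text \<open>
  Outer regularity: the preimage lies in open sets of almost the same measure, and
  the images of these sets cover \<open>A\<close>.
\<close>
lemma emeasure_le_vimage_nonexpansive:
  fixes g :: "real \<Rightarrow> real"
  assumes "open S" and A: "A \<in> sets borel" "A \<subseteq> g ` S"
    and nonexp: "\<And>x y. x \<in> S \<Longrightarrow> y \<in> S \<Longrightarrow> \<bar>g x - g y\<bar> \<le> \<bar>x - y\<bar>"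
  shows "emeasure lborel A \<le> emeasure lborel (g -` A \<inter> S)"
proof (rule ennreal_le_epsilon)
  fix e :: real assume e: "0 < e"
  let ?B = "g -` A \<inter> S"
  have B: "?B \<in> sets borel"
    using measurable_sets[OF nonexpansive_measurable[of S g] A(1)] nonexp assms(1)
    by (auto simp: space_restrict_space sets_restrict_space_iff)
  then obtain T where T: "open T" "?B \<subseteq> T" "emeasure lebesgue (T - ?B) < ennreal e"
    using sets_lebesgue_outer_open[of ?B e] e by (metis sets_completionI_sets sets_lborel)
  have "A \<subseteq> g ` (T \<inter> S)" using A(2) T(2) by blast
  then have "emeasure lborel A \<le> emeasure lborel (T \<inter> S)"
    using assms T by (intro emeasure_nonexpansive_image_open[where g = g]) auto
  also have "\<dots> \<le> emeasure lborel (?B \<union> (T - ?B))"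
    using B T(1) by (intro emeasure_mono) auto
  also have "\<dots> \<le> emeasure lborel ?B + emeasure lborel (T - ?B)"
    using B T(1) by (intro emeasure_subadditive) auto
  also have "emeasure lborel (T - ?B) = emeasure lebesgue (T - ?B)"
    using B T(1) by simp
  also have "emeasure lborel ?B + \<dots> \<le> emeasure lborel ?B + ennreal e"
    using T(3) by (intro add_left_mono) auto
  finally show "emeasure lborel A \<le> emeasure lborel ?B + ennreal e" .
qed

text \<open>
  A one-sided change of variables. The previous bound says that Lebesgue measure on the image
  is dominated, as a measure, by the push-forward of Lebesgue measure on \<open>S\<close>;
  integrals of nonnegative functions are monotone in the measure.
\<close>
lemma nn_integral_le_nonexpansive:
  fixes g :: "real \<Rightarrow> real" and f :: "real \<Rightarrow> ennreal"
  assumes S: "open S" and nonexp: "\<And>x y. x \<in> S \<Longrightarrow> y \<in> S \<Longrightarrow> \<bar>g x - g y\<bar> \<le> \<bar>x - y\<bar>"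
    and gS: "g ` S \<in> sets borel" and f: "f \<in> borel_measurable borel"
  shows "(\<integral>\<^sup>+x\<in>g ` S. f x \<partial>lborel) \<le> (\<integral>\<^sup>+y\<in>S. f (g y) \<partial>lborel)"
proof -
  let ?R = "restrict_space lborel S"
  let ?D = "distr ?R borel g"
  let ?E = "density lborel (indicator (g ` S))"
  have g: "g \<in> borel_measurable ?R"
    using nonexpansive_measurable[OF nonexp]
    by (simp add: measurable_cong_sets[OF sets_restrict_space_cong[OF sets_lborel] refl])
  have "emeasure ?E A \<le> emeasure ?D A" if "A \<in> sets borel" for A
  proof -
    have "emeasure ?E A = emeasure lborel (A \<inter> g ` S)"
      using that gS by (simp add: emeasure_density indicator_inter_arith[symmetric] Int_commute)
    also have "\<dots> \<le> emeasure lborel (g -` (A \<inter> g ` S) \<inter> S)"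
      using that gS nonexp by (intro emeasure_le_vimage_nonexpansive[OF S]) auto
    also have "g -` (A \<inter> g ` S) \<inter> S = g -` A \<inter> space ?R"
      by (auto simp: space_restrict_space)
    also have "emeasure lborel \<dots> = emeasure ?D A"
      using g that S by (simp add: emeasure_distr emeasure_restrict_space space_restrict_space)
    finally show ?thesis .
  qed
  then have "?E \<le> ?D"
    by (subst le_measure) (auto simp: le_fun_def)
  then have "nn_integral ?E f \<le> nn_integral ?D f"
    by (intro nn_integral_mono_measure) auto
  moreover have "nn_integral ?E f = (\<integral>\<^sup>+x\<in>g ` S. f x \<partial>lborel)"
    using f gS by (subst nn_integral_density) (auto simp: mult.commute)
  moreover have "nn_integral ?D f = (\<integral>\<^sup>+y\<in>S. f (g y) \<partial>lborel)"
    using f g S by (simp add: nn_integral_distr nn_integral_restrict_space)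
  ultimately show ?thesis by simp
qed

section \<open>Comparison of the entropies\<close>

text \<open>
  The map \<open>g\<close> sends the quantile of \<open>X2\<close> to the quantile of \<open>X1\<close> at each level. The dispersive
  order bounds its increments. For \<open>g y \<le> y\<close>, compare \<open>y\<close> with points \<open>z\<close> whose image is
  close to \<open>0\<close>: the increment bound gives \<open>g y \<le> g z + (y - z) < g z + y\<close>.
\<close>
lemma disp_le_transport:
  assumes "prob_space M1" "prob_space M2" "abs_continuous_rv M1 X1" "abs_continuous_rv M2 X2"
    and "AE \<omega> in M1. 0 \<le> X1 \<omega>" "AE \<omega> in M2. 0 \<le> X2 \<omega>" "0 < s1" "0 < s2"
    and "has_support_upto M1 X1 s1" "has_support_upto M2 X2 s2"
    and disp: "disp_le M1 X1 M2 X2"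
  obtains g where "g ` einterval 0 s2 = einterval 0 s1"
    and "\<And>x y. x \<in> einterval 0 s2 \<Longrightarrow> y \<in> einterval 0 s2 \<Longrightarrow> \<bar>g x - g y\<bar> \<le> \<bar>x - y\<bar>"
    and "\<And>y. y \<in> einterval 0 s2 \<Longrightarrow> g y \<le> y"
    and "\<And>y. y \<in> einterval 0 s2 \<Longrightarrow> rv_cdf M1 X1 (g y) = rv_cdf M2 X2 y"
proof -
  let ?I1 = "einterval 0 s1" and ?I2 = "einterval 0 s2"
  let ?K1 = "rv_cdf M1 X1" and ?K2 = "rv_cdf M2 X2"
  have bij1: "bij_betw ?K1 ?I1 {0<..<1}" and bij2: "bij_betw ?K2 ?I2 {0<..<1}"
    using rv_cdf_bij_betw assms by blast+
  define g where "g = rc_inverse ?K1 \<circ> ?K2"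
  have inv1: "rc_inverse ?K1 (?K1 x) = x" if "x \<in> ?I1" for x
    using rc_inverse_rv_cdf assms that by blast
  have inv2: "rc_inverse ?K2 (?K2 x) = x" if "x \<in> ?I2" for x
    using rc_inverse_rv_cdf assms that by blast
  have g: "g y \<in> ?I1 \<and> ?K1 (g y) = ?K2 y" if "y \<in> ?I2" for y
  proof -
    have "?K2 y \<in> ?K1 ` ?I1"
      using bij1 bij2 that by (auto simp: bij_betw_def)
    then show ?thesis by (auto simp: g_def inv1)
  qed
  have onto: "\<exists>y\<in>?I2. g y = x" if "x \<in> ?I1" for x
  proof -
    have "?K1 x \<in> ?K2 ` ?I2"
      using bij1 bij2 that by (auto simp: bij_betw_def)
    then show ?thesis using inv1[OF that] by (force simp: g_def)
  qed
  have step: "g y - g x \<le> y - x \<and> g x \<le> g y" if xy: "x \<in> ?I2" "y \<in> ?I2" "x < y" for x y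
  proof -
    have lt: "?K2 x < ?K2 y"
      using rv_cdf_strict_mono[OF assms(2,4,10)] xy by (auto simp: einterval_def)
    moreover have "0 < ?K2 x" "?K2 y < 1"
      using bij2 xy by (auto simp: bij_betw_def)
    ultimately have "g x - g y \<ge> x - y"
      using disp inv2 xy by (force simp: disp_le_def g_def)
    moreover have "g x \<le> g y"
      using lt g[OF xy(1)] g[OF xy(2)] monoD[OF mono_rv_cdf[OF assms(1,3)]]
      by (metis linorder_not_le nle_le)
    ultimately show ?thesis by simp
  qed
  have nonexp: "\<bar>g x - g y\<bar> \<le> \<bar>x - y\<bar>" if "x \<in> ?I2" "y \<in> ?I2" for x y
    using step[OF that] step[OF that(2,1)] by (cases x y rule: linorder_cases) auto
  have "g y \<le> y" if y: "y \<in> ?I2" for y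
  proof (rule ccontr)
    assume "\<not> g y \<le> y"
    then have gt: "y < g y" by simp
    \<comment> \<open>Any positive value below \<open>g y - y\<close> serves: as \<open>z > 0\<close>, an increment from \<open>\<epsilon>\<close> to \<open>g y\<close> exceeds \<open>y - z\<close>.\<close>
    define \<epsilon> where "\<epsilon> = (g y - y) / 2"
    have "0 < y" using y by (auto simp: einterval_def)
    then have "0 < \<epsilon>" "\<epsilon> < g y" using gt by (auto simp: \<epsilon>_def field_simps)
    then have "\<epsilon> \<in> ?I1"
      using g[OF y] by (auto simp: einterval_def intro: less_trans[of "ereal \<epsilon>" "ereal (g y)"])
    then obtain z where z: "z \<in> ?I2" "g z = \<epsilon>" using onto by blast
    have "0 < z" using z by (auto simp: einterval_def)
    then show False
      using step[OF z(1) y] step[OF y z(1)] z gt \<open>\<epsilon> < g y\<close> \<open>0 < y\<close>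
      by (cases z y rule: linorder_cases) (auto simp: \<epsilon>_def field_simps)
  qed
  moreover have "g ` ?I2 = ?I1" using g onto by blast
  ultimately show thesis using that[of g] nonexp g by blast
qed

lemma interval_integral_eq_nn_integral:
  assumes "a \<le> b" "interval_lebesgue_integrable lborel a b f"
    and "\<And>x. x \<in> einterval a b \<Longrightarrow> 0 \<le> f x"
  shows "ennreal (LBINT x=a..b. f x) = (\<integral>\<^sup>+x\<in>einterval a b. ennreal (f x) \<partial>lborel)"
proof -
  have int: "integrable lborel (\<lambda>x. indicator (einterval a b) x * f x)"
    using assms(1,2) by (simp add: interval_lebesgue_integrable_def set_integrable_def)
  have "(\<integral>\<^sup>+x\<in>einterval a b. ennreal (f x) \<partial>lborel) =
      (\<integral>\<^sup>+x. ennreal (indicator (einterval a b) x * f x) \<partial>lborel)"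
    by (intro nn_integral_cong) (auto split: split_indicator)
  also have "\<dots> = ennreal (\<integral>x. indicator (einterval a b) x * f x \<partial>lborel)"
    using assms(3) by (intro nn_integral_eq_integral int AE_I2) (auto split: split_indicator)
  finally show ?thesis
    using assms(1) by (simp add: interval_lebesgue_integral_def set_lebesgue_integral_def)
qed

theorem proposition2p3:
  fixes M1 :: "'a measure" and M2 :: "'b measure"
    and X1 :: "'a \<Rightarrow> real" and X2 :: "'b \<Rightarrow> real"
    and s1 s2 :: ereal and \<gamma> :: real and \<psi> :: "real \<Rightarrow> real"
  assumes "prob_space M1" and "prob_space M2"
    and "abs_continuous_rv M1 X1" and "abs_continuous_rv M2 X2"
    and "AE \<omega> in M1. 0 \<le> X1 \<omega>" and "AE \<omega> in M2. 0 \<le> X2 \<omega>"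
    and "0 < s1" and "0 < s2"
    and "has_support_upto M1 X1 s1" and "has_support_upto M2 X2 s2"
    and "0 < \<gamma>"
    and "\<forall>x \<in> einterval 0 s1 \<union> einterval 0 s2. 0 \<le> \<psi> x"
    and "mono_on (einterval 0 s1 \<union> einterval 0 s2) \<psi>"
    and "wfgcpe_exists \<gamma> \<psi> M1 X1 s1" and "wfgcpe_exists \<gamma> \<psi> M2 X2 s2"
    and "disp_le M1 X1 M2 X2"
  shows "wfgcpe \<gamma> \<psi> M1 X1 s1 \<le> wfgcpe \<gamma> \<psi> M2 X2 s2"
proof -
  let ?I1 = "einterval 0 s1" and ?I2 = "einterval 0 s2"
  let ?f1 = "wfgcpe_integrand \<gamma> \<psi> (rv_cdf M1 X1)" and ?f2 = "wfgcpe_integrand \<gamma> \<psi> (rv_cdf M2 X2)"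
  obtain g where img: "g ` ?I2 = ?I1"
    and nonexp: "\<And>x y. x \<in> ?I2 \<Longrightarrow> y \<in> ?I2 \<Longrightarrow> \<bar>g x - g y\<bar> \<le> \<bar>x - y\<bar>"
    and le: "\<And>y. y \<in> ?I2 \<Longrightarrow> g y \<le> y"
    and K: "\<And>y. y \<in> ?I2 \<Longrightarrow> rv_cdf M1 X1 (g y) = rv_cdf M2 X2 y"
    using disp_le_transport[OF assms(1-10,16)] by blast
  have cdf_nonneg: "0 \<le> rv_cdf M1 X1 x" "0 \<le> rv_cdf M2 X2 x" for x
    by (simp_all add: rv_cdf_def cdf_def)
  have nonneg1: "0 \<le> ?f1 x" if "x \<in> ?I1" for x
    using assms(12) that cdf_nonneg by (auto simp: wfgcpe_integrand_def)
  have nonneg2: "0 \<le> ?f2 x" if "x \<in> ?I2" for x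
    using assms(12) that cdf_nonneg by (auto simp: wfgcpe_integrand_def)
  have pointwise: "?f1 (g y) \<le> ?f2 y" if y: "y \<in> ?I2" for y
  proof -
    have "\<psi> (g y) \<le> \<psi> y"
      using assms(13) img y le[OF y] by (auto intro: mono_onD)
    then show ?thesis
      using cdf_nonneg(2) by (simp add: wfgcpe_integrand_def K[OF y] mult_right_mono)
  qed
  have int1: "interval_lebesgue_integrable lborel 0 s1 ?f1"
    and int2: "interval_lebesgue_integrable lborel 0 s2 ?f2"
    using assms(14,15) by (simp_all add: wfgcpe_exists_def)
  \<comment> \<open>Cutting the first integrand off outside \<open>(0, s1)\<close> makes it Borel measurable on the whole line;
      integrability of \<open>?f1\<close> gives measurability only inside that interval.\<close>
  let ?h = "\<lambda>x. ennreal (indicator ?I1 x * ?f1 x)"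
  have h: "?h \<in> borel_measurable borel"
  proof -
    have "(\<lambda>x. indicator ?I1 x * ?f1 x) \<in> borel_measurable lborel"
      using int1 assms(7) borel_measurable_integrable[of lborel "\<lambda>x. indicator ?I1 x * ?f1 x"]
      by (simp add: interval_lebesgue_integrable_def set_integrable_def less_imp_le)
    then show ?thesis by simp
  qed
  have "ennreal (LBINT x=0..s1. ?f1 x) = (\<integral>\<^sup>+x\<in>?I1. ennreal (?f1 x) \<partial>lborel)"
    using assms(7) int1 nonneg1 by (intro interval_integral_eq_nn_integral) auto
  also have "\<dots> = (\<integral>\<^sup>+x\<in>g ` ?I2. ?h x \<partial>lborel)"
    unfolding img by (intro nn_integral_cong) (auto split: split_indicator)
  also have "\<dots> \<le> (\<integral>\<^sup>+y\<in>?I2. ?h (g y) \<partial>lborel)"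
    using h nonexp by (intro nn_integral_le_nonexpansive) (auto simp: img)
  also have "\<dots> \<le> (\<integral>\<^sup>+y\<in>?I2. ennreal (?f2 y) \<partial>lborel)"
    using pointwise img by (intro nn_integral_mono) (auto split: split_indicator intro: ennreal_leI)
  also have "\<dots> = ennreal (LBINT x=0..s2. ?f2 x)"
    using assms(8) int2 nonneg2 by (intro interval_integral_eq_nn_integral[symmetric]) auto
  finally have "ennreal (LBINT x=0..s1. ?f1 x) \<le> ennreal (LBINT x=0..s2. ?f2 x)" .
  moreover have "0 \<le> (LBINT x=0..s2. ?f2 x)"
    using assms(8) nonneg2
    by (auto simp: interval_lebesgue_integral_def set_lebesgue_integral_def
        intro!: integral_nonneg_AE AE_I2 split: split_indicator)
  ultimately have "(LBINT x=0..s1. ?f1 x) \<le> (LBINT x=0..s2. ?f2 x)"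
    by (simp add: ennreal_le_iff)
  moreover have "0 < Gamma (\<gamma> + 1)"
    using assms(11) by (intro Gamma_real_pos) simp
  ultimately show ?thesis
    unfolding wfgcpe_def by (intro mult_left_mono) auto
qed

end
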